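(* Let $f(\mathbf z,\bar{\mathbf z})$ be a mixed polynomial on $\mathbb C^n$ satisfying Thom's $a_f$-condition at $\mathbf 0$ (with respect to some Whitney regular stratification $\mathcal S$ of $\mathbb C^n$ for which $V=f^{-1}(0)$ is a union of strata), and suppose that the nearby fibers are smooth. Then there exists $r_0>0$ such that for any $0<r_1\le r_0$ there exists a positive $\delta$ such that every nearby fiber $V_\eta=f^{-1}(\eta)$ with $0<|\eta|\le\delta$ intersects the sphere $S_r$ transversely for every $r$ with $r_1\le r\le r_0$.
   Context: A mixed polynomial is a finite sum $f(\mathbf z,\bar{\mathbf z})=\sum_{\nu,\mu}c_{\nu\mu}\mathbf z^\nu\bar{\mathbf z}^\mu$, $\mathbf z\in\mathbb C^n$, viewed as a map $\mathbb R^{2n}\to\mathbb R^2$. $B_r,S_r$ denote the ball and sphere of radius $r$ centered at the origin of $\mathbb C^n$. "Nearby fibers are smooth" means: there are $r>0$ and $0<\delta\ll r$ such that for $0<|\eta|\le\delta$ the fiber $V_\eta$ contains no critical point of $f$ (point where the real differential of $f$ has rank $<2$) in $B_r$. $a_f$-condition: let $\mathcal S$ be a Whitney regular stratification of $\mathbb C^n$ such that $V$ is a union of strata. $f$ satisfies Thom's $a_f$-condition with respect to $\mathcal S$ (locally at $\mathbf 0$) if there are $r>0$ and $0<\delta\ll r$ such that $V_\eta$ is smooth in $B_r$ for $0<|\eta|\le\delta$, and for any sequence $\mathbf z^{(\nu)}$ in $B_r$ with $f(\mathbf z^{(\nu)})\ne0$ converging to a point $\mathbf w\ne\mathbf 0$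 with $\mathbf w\in M$, $M\subset V$ a stratum of $\mathcal S$, such that the tangent spaces $T_{\mathbf z^{(\nu)}}f^{-1}(f(\mathbf z^{(\nu)}))$ converge to some $\tau$ in the Grassmannian of real $(2n-2)$-planes, one has $T_{\mathbf w}M\subset\tau$. *)

theory Defs
  imports "HOL-Analysis.Analysis"
begin

section \<open>Mixed polynomials\<close>

text \<open>Exponents \<open>\<nu>, \<mu>\<close> are functions from the finite index type \<open>'n\<close> to \<open>nat\<close>.\<close>

definition mixed_polynomial :: "(complex ^ 'n \<Rightarrow> complex) \<Rightarrow> bool" where
  "mixed_polynomial f \<longleftrightarrow>
     (\<exists>(A :: (('n \<Rightarrow> nat) \<times> ('n \<Rightarrow> nat)) set) c. finite A \<and>
        f = (\<lambda>z. \<Sum>(\<nu>, \<mu>)\<in>A. c \<nu> \<mu> * (\<Prod>i\<in>UNIV. (z $ i) ^ \<nu> i) * (\<Prod>i\<in>UNIV. cnj (z $ i) ^ \<mu> i)))"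

text \<open>All linear algebra is over the reals: \<open>frechet_derivative\<close>, \<open>dim\<close>, \<open>subspace\<close> and \<open>span\<close>
  see \<open>complex ^ 'n\<close> as a Euclidean space of dimension \<open>2 * CARD('n)\<close>.\<close>

definition critical_point :: "('a::euclidean_space \<Rightarrow> complex) \<Rightarrow> 'a \<Rightarrow> bool" where
  "critical_point f z \<longleftrightarrow> dim (range (frechet_derivative f (at z))) < 2"

definition fibers_smooth_in :: "(complex ^ 'n \<Rightarrow> complex) \<Rightarrow> real \<Rightarrow> real \<Rightarrow> bool" where
  "fibers_smooth_in f r \<delta> \<longleftrightarrow>
     (\<forall>\<eta>. 0 < norm \<eta> \<and> norm \<eta> \<le> \<delta> \<longrightarrow> (\<forall>z \<in> f -` {\<eta>} \<inter> cball 0 r. \<not> critical_point f z))"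

text \<open>The condition is inherited by smaller \<open>\<delta>\<close>, so choosing \<open>\<delta>\<close> much smaller than \<open>r\<close>
  imposes nothing beyond \<open>\<delta> > 0\<close>.\<close>

definition nearby_fibers_smooth :: "(complex ^ 'n \<Rightarrow> complex) \<Rightarrow> bool" where
  "nearby_fibers_smooth f \<longleftrightarrow> (\<exists>r>0. \<exists>\<delta>>0. fibers_smooth_in f r \<delta>)"

section \<open>Submanifolds, tangent spaces, Grassmannians\<close>

text \<open>\<open>Ck_on k U f\<close> is meant for open \<open>U\<close>; in finite dimension, continuity of all directional
  derivatives of the derivative is continuity of the derivative itself.\<close>

primrec Ck_on :: "nat \<Rightarrow> 'a::euclidean_space set \<Rightarrow> ('a \<Rightarrow> 'b::real_normed_vector) \<Rightarrow> bool" where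
  "Ck_on 0 U f \<longleftrightarrow> continuous_on U f"
| "Ck_on (Suc k) U f \<longleftrightarrow> (\<forall>x\<in>U. f differentiable (at x)) \<and>
     (\<forall>v. Ck_on k U (\<lambda>x. frechet_derivative f (at x) v))"

definition smooth_on :: "'a::euclidean_space set \<Rightarrow> ('a \<Rightarrow> 'b::real_normed_vector) \<Rightarrow> bool" where
  "smooth_on U f \<longleftrightarrow> (\<forall>k. Ck_on k U f)"

text \<open>Embedded \<open>d\<close>-dimensional \<open>C\<^sup>\<infinity>\<close> submanifolds, via slice charts; they need not be closed
  or connected.\<close>

definition smooth_submanifold :: "nat \<Rightarrow> 'a::euclidean_space set \<Rightarrow> bool" where
  "smooth_submanifold d M \<longleftrightarrow>
     (\<forall>p\<in>M. \<exists>U V (\<phi> :: 'a \<Rightarrow> 'a) \<psi> L. open U \<and> p \<in> U \<and> open V \<and>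
        homeomorphism U V \<phi> \<psi> \<and> smooth_on U \<phi> \<and> smooth_on V \<psi> \<and>
        subspace L \<and> dim L = d \<and> \<phi> ` (U \<inter> M) = V \<inter> L)"

text \<open>Velocities of curves in \<open>M\<close>.  For an embedded submanifold, curves that are merely
  differentiable at \<open>0\<close> have the same velocities as smooth ones.\<close>

definition tangent_space :: "'a::euclidean_space set \<Rightarrow> 'a \<Rightarrow> 'a set" where
  "tangent_space M p = {v. \<exists>\<gamma> :: real \<Rightarrow> 'a. \<exists>e>0. \<gamma> 0 = p \<and> (\<forall>t\<in>{-e<..<e}. \<gamma> t \<in> M) \<and>
     (\<gamma> has_vector_derivative v) (at 0)}"

definition grassmannian :: "nat \<Rightarrow> 'a::euclidean_space set set" where
  "grassmannian k = {W. subspace W \<and> dim W = k}"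

text \<open>On a subspace, \<open>closest_point\<close> is the orthogonal projection; the operator norm of the
  difference of projections is the usual metric on the Grassmannian.\<close>

definition grassmannian_lim ::
    "nat \<Rightarrow> (nat \<Rightarrow> 'a::euclidean_space set) \<Rightarrow> 'a set \<Rightarrow> bool" where
  "grassmannian_lim k W \<tau> \<longleftrightarrow> (\<forall>i. W i \<in> grassmannian k) \<and> \<tau> \<in> grassmannian k \<and>
     (\<lambda>i. onorm (\<lambda>x. closest_point (W i) x - closest_point \<tau> x)) \<longlonglongrightarrow> 0"

definition transverse_at :: "'a::euclidean_space set \<Rightarrow> 'a set \<Rightarrow> 'a \<Rightarrow> bool" where
  "transverse_at M N p \<longleftrightarrow> {u + v |u v. u \<in> tangent_space M p \<and> v \<in> tangent_space N p} = UNIV"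

section \<open>Whitney regular stratifications\<close>

definition whitney_a :: "'a::euclidean_space set \<Rightarrow> 'a set \<Rightarrow> bool" where
  "whitney_a X Y \<longleftrightarrow>
     (\<forall>x y k \<tau>. (\<forall>i. x i \<in> X) \<and> y \<in> Y \<and> x \<longlonglongrightarrow> y \<and>
        grassmannian_lim k (\<lambda>i. tangent_space X (x i)) \<tau> \<longrightarrow> tangent_space Y y \<subseteq> \<tau>)"

definition whitney_b :: "'a::euclidean_space set \<Rightarrow> 'a set \<Rightarrow> bool" where
  "whitney_b X Y \<longleftrightarrow>
     (\<forall>x y' y k \<tau> l. (\<forall>i. x i \<in> X) \<and> (\<forall>i. y' i \<in> Y) \<and> y \<in> Y \<and> x \<longlonglongrightarrow> y \<and> y' \<longlonglongrightarrow> y \<and>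
        grassmannian_lim k (\<lambda>i. tangent_space X (x i)) \<tau> \<and>
        grassmannian_lim 1 (\<lambda>i. span {x i - y' i}) l \<longrightarrow> l \<subseteq> \<tau>)"

definition whitney_stratification :: "'a::euclidean_space set set \<Rightarrow> bool" where
  "whitney_stratification \<S> \<longleftrightarrow>
     partition_on UNIV \<S> \<and>
     (\<forall>x. \<exists>U. open U \<and> x \<in> U \<and> finite {M \<in> \<S>. M \<inter> U \<noteq> {}}) \<and>
     (\<forall>M\<in>\<S>. \<exists>d. smooth_submanifold d M) \<and>
     (\<forall>X\<in>\<S>. \<forall>Y\<in>\<S>. Y \<inter> closure X \<noteq> {} \<longrightarrow> Y \<subseteq> closure X) \<and>
     (\<forall>X\<in>\<S>. \<forall>Y\<in>\<S>. X \<noteq> Y \<longrightarrow> whitney_a X Y \<and> whitney_b X Y)"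

section \<open>Thom's condition and transversality to spheres\<close>

definition thom_af :: "(complex ^ 'n \<Rightarrow> complex) \<Rightarrow> (complex ^ 'n) set set \<Rightarrow> bool" where
  "thom_af f \<S> \<longleftrightarrow>
     (\<exists>r>0. \<exists>\<delta>>0. fibers_smooth_in f r \<delta> \<and>
        (\<forall>z w M \<tau>. (\<forall>i. z i \<in> cball 0 r \<and> f (z i) \<noteq> 0) \<and> z \<longlonglongrightarrow> w \<and> w \<noteq> 0 \<and>
           M \<in> \<S> \<and> M \<subseteq> f -` {0} \<and> w \<in> M \<and>
           grassmannian_lim (2 * CARD('n) - 2) (\<lambda>i. tangent_space (f -` {f (z i)}) (z i)) \<tau>
           \<longrightarrow> tangent_space M w \<subseteq> \<tau>))"

text \<open>Transversality presupposes that the fiber is a manifold at the points of intersection,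
  hence the regularity clause.\<close>

definition fiber_transverse_sphere ::
    "(complex ^ 'n \<Rightarrow> complex) \<Rightarrow> complex \<Rightarrow> real \<Rightarrow> bool" where
  "fiber_transverse_sphere f \<eta> r \<longleftrightarrow>
     (\<forall>z \<in> f -` {\<eta>} \<inter> sphere 0 r. \<not> critical_point f z \<and> transverse_at (f -` {\<eta>}) (sphere 0 r) z)"

end

theory Submission
  imports Defs
begin

text \<open>
  The sphere of radius \<open>norm z\<close> and the fiber through a regular point \<open>z \<noteq> 0\<close> are transverse as soon as
  the fiber has a tangent vector \<open>v\<close> at \<open>z\<close> with \<open>v \<bullet> z \<noteq> 0\<close>, since the tangent space of the sphere is
  the hyperplane orthogonal to \<open>z\<close> (\<open>transverse_at_sphereI\<close>). Two facts produce such vectors.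

  First, small spheres are transverse to all strata (\<open>small_spheres_transverse_to_strata\<close>): if the
  tangent spaces of a stratum were orthogonal to the position vectors \<open>x n\<close> along a sequence
  \<open>x n \<longlonglongrightarrow> 0\<close> in it, then in the limit a secant direction would be both orthogonal to the limiting
  tangent space and, by Whitney's condition (b) at the origin, contained in it. On the stratum
  through the origin, continuity of its tangent spaces replaces condition (b). This bounds \<open>r0\<close>.

  Second, Thom's condition carries transversality from the strata in \<open>f -` {0}\<close> to the nearby fibers.
  Suppose that for fixed \<open>r1 > 0\<close> there were points \<open>z n\<close> in the shell between the radii \<open>r1\<close> and \<open>r0\<close>
  with \<open>0 \<noteq> f (z n) \<longlonglongrightarrow> 0\<close> whose fibers have all their tangent vectors orthogonal to \<open>z n\<close>. The shell
  and the Grassmannian are compact (\<open>grassmannian_compact\<close>), so after passing to a subsequence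
  \<open>z n \<longlonglongrightarrow> w\<close> with \<open>f w = 0\<close> and \<open>w \<noteq> 0\<close>, and the tangent spaces converge to some \<open>\<tau>\<close> orthogonal to \<open>w\<close>.
  By Thom's condition \<open>\<tau>\<close> contains the tangent space at \<open>w\<close> of the stratum through \<open>w\<close>, which is
  therefore orthogonal to \<open>w\<close>, against the first fact. The lower bound \<open>r1\<close> on the radius is what
  keeps \<open>w\<close> away from the origin, where Thom's condition says nothing.

  Tangent spaces are sets of velocities of curves, and the limit conditions speak only of subspaces of
  a fixed dimension. So the argument needs that a fiber at a noncritical point has the kernel of the
  derivative as its tangent space (\<open>tangent_space_level_set\<close>, from the inverse function theorem), and
  that the tangent spaces of a submanifold are subspaces of its dimension
  (\<open>tangent_space_in_grassmannian\<close>, from slice charts).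
\<close>

section \<open>Orthogonal projections and compactness of the Grassmannian\<close>

lemma closest_point_subspace_in:
  fixes W :: "'a::euclidean_space set"
  assumes "subspace W" shows "closest_point W x \<in> W"
  using assms by (intro closest_point_in_set closed_subspace) (auto dest: subspace_0)

text \<open>The obtuse-angle characterisation of nearest points in a convex set, applied to the two points
  \<open>p + y\<close> and \<open>p - y\<close> of the subspace, gives two opposite inequalities.\<close>

lemma closest_point_subspace_orthogonal:
  fixes W :: "'a::euclidean_space set"
  assumes W: "subspace W" and y: "y \<in> W"
  shows "(x - closest_point W x) \<bullet> y = 0"
proof -
  let ?p = "closest_point W x"
  have p: "?p \<in> W" using closest_point_subspace_in[OF W] .
  have "?p + y \<in> W" "?p - y \<in> W"
    using p y W by (auto intro: subspace_add subspace_diff)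
  then have "(x - ?p) \<bullet> ((?p + y) - ?p) \<le> 0" "(x - ?p) \<bullet> ((?p - y) - ?p) \<le> 0"
    using closest_point_dot W by (blast intro: subspace_imp_convex closed_subspace)+
  then show ?thesis by (simp add: inner_diff_right)
qed

lemma closest_point_subspace_eqI:
  fixes W :: "'a::euclidean_space set"
  assumes W: "subspace W" and p: "p \<in> W" and orth: "\<And>y. y \<in> W \<Longrightarrow> (x - p) \<bullet> y = 0"
  shows "closest_point W x = p"
proof -
  let ?q = "closest_point W x"
  have "p - ?q \<in> W" using p closest_point_subspace_in[OF W] W by (auto intro: subspace_diff)
  then have "(x - ?q) \<bullet> (p - ?q) = 0" "(x - p) \<bullet> (p - ?q) = 0"
    using closest_point_subspace_orthogonal[OF W] orth by auto
  then have "((x - ?q) - (x - p)) \<bullet> (p - ?q) = 0" by (simp only: inner_diff_left)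
  then show ?thesis by simp
qed

lemma norm_closest_point_subspace_le:
  fixes W :: "'a::euclidean_space set"
  assumes W: "subspace W"
  shows "norm (closest_point W x) \<le> norm x"
proof -
  let ?p = "closest_point W x"
  have "?p \<bullet> ?p = x \<bullet> ?p"
    using closest_point_subspace_orthogonal[OF W closest_point_subspace_in[OF W], of x x]
    by (simp add: inner_diff_left)
  then have "norm ?p * norm ?p \<le> norm x * norm ?p"
    by (metis norm_cauchy_schwarz power2_eq_square power2_norm_eq_inner)
  then show ?thesis
    by (metis mult_right_le_imp_le norm_ge_zero order_le_less)
qed

lemma bounded_linear_closest_point_subspace:
  fixes W :: "'a::euclidean_space set"
  assumes W: "subspace W"
  shows "bounded_linear (closest_point W)"
proof (rule bounded_linear_intro[where K = 1])
  note in_W = closest_point_subspace_in[OF W] and orth = closest_point_subspace_orthogonal[OF W]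
  show "closest_point W (x + y) = closest_point W x + closest_point W y" for x y
  proof (rule closest_point_subspace_eqI[OF W])
    show "(x + y - (closest_point W x + closest_point W y)) \<bullet> u = 0" if "u \<in> W" for u
      using orth[OF that, of x] orth[OF that, of y] by (simp add: algebra_simps)
  qed (simp add: in_W W subspace_add)
  show "closest_point W (c *\<^sub>R x) = c *\<^sub>R closest_point W x" for c x
  proof (rule closest_point_subspace_eqI[OF W])
    show "(c *\<^sub>R x - c *\<^sub>R closest_point W x) \<bullet> u = 0" if "u \<in> W" for u
      using orth[OF that, of x] by (simp flip: scaleR_diff_right)
  qed (simp add: in_W W subspace_scale)
  show "norm (closest_point W x) \<le> norm x * 1" for x
    using norm_closest_point_subspace_le[OF W] by simp
qed

text \<open>Bounded linear endomorphisms of a Euclidean space form a complete normed space in which bounded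
  sequences have convergent subsequences. Packaging projections in this type makes the Grassmannian
  metric the norm distance and gives access to that compactness.\<close>

definition subspace_projection :: "'a::euclidean_space set \<Rightarrow> 'a \<Rightarrow>\<^sub>L 'a" where
  "subspace_projection W = Blinfun (closest_point W)"

lemma subspace_projection_apply:
  "subspace W \<Longrightarrow> blinfun_apply (subspace_projection W) = closest_point W"
  by (simp add: subspace_projection_def bounded_linear_Blinfun_apply
      bounded_linear_closest_point_subspace)

lemma grassmannian_lim_iff_tendsto_projection:
  "grassmannian_lim k W \<tau> \<longleftrightarrow> (\<forall>i. W i \<in> grassmannian k) \<and> \<tau> \<in> grassmannian k \<and>
     (\<lambda>i. subspace_projection (W i)) \<longlonglongrightarrow> subspace_projection \<tau>"
proof -
  have "onorm (\<lambda>x. closest_point (W i) x - closest_point \<tau> x)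
      = norm (subspace_projection (W i) - subspace_projection \<tau>)"
    if "W i \<in> grassmannian k" "\<tau> \<in> grassmannian k" for i
    using that
    by (simp add: norm_blinfun.rep_eq minus_blinfun.rep_eq subspace_projection_apply grassmannian_def)
  then show ?thesis
    unfolding grassmannian_lim_def by (subst (2) LIM_zero_iff[symmetric]) (auto simp: tendsto_norm_zero_iff)
qed

text \<open>If the projection onto \<open>W\<close> killed a nonzero \<open>x \<in> V\<close>, the difference of the projections would map
  \<open>x\<close> to itself and so have norm at least 1. Hence \<open>V\<close> embeds linearly into \<open>W\<close>. This is what keeps
  the dimension from dropping in a limit.\<close>

lemma dim_le_if_projections_close:
  fixes V W :: "'a::euclidean_space set"
  assumes V: "subspace V" and W: "subspace W"
    and close: "norm (subspace_projection V - subspace_projection W) < 1"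
  shows "dim V \<le> dim W"
proof -
  interpret P: bounded_linear "closest_point W"
    by (rule bounded_linear_closest_point_subspace[OF W])
  have "inj_on (closest_point W) V"
  proof (rule linear_inj_on_iff_eq_0[OF P.linear V, THEN iffD2], safe)
    fix x assume x: "x \<in> V" "closest_point W x = 0"
    have "norm x = norm ((subspace_projection V - subspace_projection W) x)"
      using x V W by (simp add: minus_blinfun.rep_eq subspace_projection_apply closest_point_self)
    also have "\<dots> \<le> norm (subspace_projection V - subspace_projection W) * norm x"
      by (rule norm_blinfun)
    finally have "norm x \<le> norm (subspace_projection V - subspace_projection W) * norm x" .
    moreover have "norm (subspace_projection V - subspace_projection W) * norm x < norm x"
      if "x \<noteq> 0" using mult_strict_right_mono[OF close, of "norm x"] that by simp
    ultimately show "x = 0" by fastforce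
  qed
  then have "dim V = dim (closest_point W ` V)"
    using dim_image_eq[OF P.linear, of V] V span_eq_iff by metis
  also have "\<dots> \<le> dim W"
    using closest_point_subspace_in[OF W] by (intro dim_subset) auto
  finally show ?thesis .
qed

text \<open>Projections have norm at most 1, so a subsequence converges to some operator \<open>Q\<close>. The identities
  \<open>P (P x) = P x\<close> and \<open>(x - P x) \<bullet> P y = 0\<close> pass to the limit and say that \<open>Q\<close> is the orthogonal
  projection onto its range, which has the right dimension because nearby projections have equal
  rank.\<close>

lemma grassmannian_compact:
  fixes W :: "nat \<Rightarrow> 'a::euclidean_space set"
  assumes W: "\<And>i. W i \<in> grassmannian k"
  obtains s \<tau> where "strict_mono s" "grassmannian_lim k (W \<circ> s) \<tau>"
proof -
  have sub: "subspace (W i)" and dim: "dim (W i) = k" for i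
    using W by (auto simp: grassmannian_def)
  define P where "P i = subspace_projection (W i)" for i
  have P: "blinfun_apply (P i) = closest_point (W i)" for i
    unfolding P_def by (rule subspace_projection_apply[OF sub])
  have "norm (P i) \<le> 1" for i
    by (rule norm_blinfun_bound) (auto simp: P norm_closest_point_subspace_le[OF sub])
  then have "bounded (range P)"
    by (auto simp: bounded_iff)
  then obtain Q s where s: "strict_mono (s :: nat \<Rightarrow> nat)" and lim: "(P \<circ> s) \<longlonglongrightarrow> Q"
    using bounded_imp_convergent_subsequence by blast
  have app: "(\<lambda>i. P (s i) x) \<longlonglongrightarrow> Q x" for x
    using lim by (intro tendsto_intros) (simp add: o_def)
  define \<tau> where "\<tau> = range Q"
  have sub\<tau>: "subspace \<tau>"
    unfolding \<tau>_def by (rule linear_subspace_image) (auto simp: bounded_linear.linear blinfun.bounded_linear_right)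
  have idem: "Q (Q x) = Q x" for x
  proof -
    have "(\<lambda>i. P (s i) (P (s i) x)) \<longlonglongrightarrow> Q (Q x)"
      using lim app by (intro tendsto_intros) (auto simp: o_def)
    moreover have "P (s i) (P (s i) x) = P (s i) x" for i
      by (simp add: P closest_point_self closest_point_subspace_in[OF sub])
    ultimately have "(\<lambda>i. P (s i) x) \<longlonglongrightarrow> Q (Q x)" by simp
    then show ?thesis using app by (rule LIMSEQ_unique)
  qed
  have orth: "(x - Q x) \<bullet> Q y = 0" for x y
  proof -
    have "(\<lambda>i. (x - P (s i) x) \<bullet> P (s i) y) \<longlonglongrightarrow> (x - Q x) \<bullet> Q y"
      by (intro tendsto_intros app)
    then show ?thesis
      by (simp add: P closest_point_subspace_orthogonal[OF sub closest_point_subspace_in[OF sub]]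
          LIMSEQ_const_iff)
  qed
  have "closest_point \<tau> x = Q x" for x
    by (rule closest_point_subspace_eqI[OF sub\<tau>]) (auto simp: \<tau>_def orth)
  then have proj: "subspace_projection \<tau> = Q"
    by (intro blinfun_eqI) (simp add: subspace_projection_apply[OF sub\<tau>])
  have "eventually (\<lambda>i. dist (P (s i)) Q < 1) sequentially"
    using lim by (auto simp: tendsto_iff o_def)
  then obtain i where i: "dist (P (s i)) Q < 1"
    by (auto simp: eventually_sequentially)
  then have "norm (subspace_projection (W (s i)) - subspace_projection \<tau>) < 1"
    by (simp add: proj dist_norm P_def)
  moreover from this have "norm (subspace_projection \<tau> - subspace_projection (W (s i))) < 1"
    by (subst norm_minus_commute)
  ultimately have "dim \<tau> = dim (W (s i))"
    by (intro order_antisym dim_le_if_projections_close sub sub\<tau>)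
  then have "dim \<tau> = k" by (simp add: dim)
  then have "grassmannian_lim k (W \<circ> s) \<tau>"
    using W sub\<tau> lim unfolding grassmannian_lim_iff_tendsto_projection
    by (simp add: grassmannian_def proj P_def o_def)
  with s that show ?thesis by blast
qed

lemma grassmannian_lim_subseq:
  assumes "grassmannian_lim k W \<tau>" "strict_mono s"
  shows "grassmannian_lim k (W \<circ> s) \<tau>"
  using assms LIMSEQ_subseq_LIMSEQ[of "\<lambda>i. subspace_projection (W i)"]
  unfolding grassmannian_lim_iff_tendsto_projection by (simp add: o_def)

text \<open>Projections fix exactly the vectors of their range, an equation that passes to the limit. This
  and its counterpart for orthogonality turn the limits in the conditions of Whitney and Thom back
  into statements about vectors.\<close>

lemma grassmannian_lim_mem:
  assumes lim: "grassmannian_lim k W \<tau>" and x: "\<And>i. x i \<in> W i" "x \<longlonglongrightarrow> a"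
  shows "a \<in> \<tau>"
proof -
  have sub: "subspace (W i)" "subspace \<tau>" for i
    using lim by (auto simp: grassmannian_lim_def grassmannian_def)
  have "(\<lambda>i. subspace_projection (W i) (x i)) \<longlonglongrightarrow> subspace_projection \<tau> a"
    using lim x by (intro tendsto_intros) (auto simp: grassmannian_lim_iff_tendsto_projection)
  moreover have "subspace_projection (W i) (x i) = x i" for i
    by (simp add: sub subspace_projection_apply closest_point_self x)
  ultimately have "x \<longlonglongrightarrow> subspace_projection \<tau> a" by simp
  then have "subspace_projection \<tau> a = a"
    using x(2) by (rule LIMSEQ_unique)
  then show ?thesis
    using closest_point_subspace_in[OF sub(2), of a] by (simp add: sub subspace_projection_apply)
qed

lemma grassmannian_lim_orthogonal:
  assumes lim: "grassmannian_lim k W \<tau>" and x: "x \<longlonglongrightarrow> a"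
    and orth: "\<And>i v. v \<in> W i \<Longrightarrow> v \<bullet> x i = 0" and v: "v \<in> \<tau>"
  shows "v \<bullet> a = 0"
proof -
  have sub: "subspace (W i)" "subspace \<tau>" for i
    using lim by (auto simp: grassmannian_lim_def grassmannian_def)
  have "(\<lambda>i. subspace_projection (W i) v \<bullet> x i) \<longlonglongrightarrow> subspace_projection \<tau> v \<bullet> a"
    using lim x by (intro tendsto_intros) (auto simp: grassmannian_lim_iff_tendsto_projection)
  moreover have "subspace_projection (W i) v \<bullet> x i = 0" for i
    by (simp add: sub subspace_projection_apply orth closest_point_subspace_in)
  moreover have "subspace_projection \<tau> v = v"
    by (simp add: sub subspace_projection_apply closest_point_self v)
  ultimately show ?thesis by (simp add: LIMSEQ_const_iff)
qed

section \<open>Continuously differentiable maps\<close>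

text \<open>The derivative is required to be continuous in the operator norm, as the inverse function theorem
  needs. For open \<open>U\<close> this is the usual class \<open>C\<^sup>1\<close>.\<close>

definition C1_on :: "'a::euclidean_space set \<Rightarrow> ('a \<Rightarrow> 'b::real_normed_vector) \<Rightarrow> bool" where
  "C1_on U f \<longleftrightarrow> (\<exists>D :: 'a \<Rightarrow> 'a \<Rightarrow>\<^sub>L 'b.
     (\<forall>x\<in>U. (f has_derivative blinfun_apply (D x)) (at x)) \<and> continuous_on U D)"

lemma C1_onE:
  fixes f :: "'a::euclidean_space \<Rightarrow> 'b::real_normed_vector"
  assumes "C1_on U f"
  obtains D :: "'a \<Rightarrow> 'a \<Rightarrow>\<^sub>L 'b"
  where "\<And>x. x \<in> U \<Longrightarrow> (f has_derivative blinfun_apply (D x)) (at x)" "continuous_on U D"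
  using assms unfolding C1_on_def by auto

lemma C1_onI:
  fixes f :: "'a::euclidean_space \<Rightarrow> 'b::real_normed_vector" and D :: "'a \<Rightarrow> 'a \<Rightarrow>\<^sub>L 'b"
  assumes "\<And>x. x \<in> U \<Longrightarrow> (f has_derivative blinfun_apply (D x)) (at x)" "continuous_on U D"
  shows "C1_on U f"
  unfolding C1_on_def by (intro exI[of _ D]) (simp add: assms)

text \<open>Continuity of finitely many directional derivatives, those along a basis, already forces
  continuity in operator norm.\<close>

lemma smooth_on_imp_C1_on:
  fixes f :: "'a::euclidean_space \<Rightarrow> 'b::real_normed_vector"
  assumes "smooth_on U f"
  shows "C1_on U f"
proof -
  have "Ck_on (Suc 0) U f"
    using assms unfolding smooth_on_def by (rule spec)
  then have diff: "\<And>x. x \<in> U \<Longrightarrow> f differentiable (at x)"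
    and cont: "\<And>v. continuous_on U (\<lambda>x. frechet_derivative f (at x) v)"
    by auto
  define D :: "'a \<Rightarrow> 'a \<Rightarrow>\<^sub>L 'b" where "D x = Blinfun (frechet_derivative f (at x))" for x
  have D: "(f has_derivative blinfun_apply (D x)) (at x)" "blinfun_apply (D x) = frechet_derivative f (at x)"
    if "x \<in> U" for x
  proof -
    have f': "(f has_derivative frechet_derivative f (at x)) (at x)"
      using diff[OF that] frechet_derivative_works by blast
    then show "blinfun_apply (D x) = frechet_derivative f (at x)"
      unfolding D_def by (intro bounded_linear_Blinfun_apply has_derivative_bounded_linear)
    then show "(f has_derivative blinfun_apply (D x)) (at x)" using f' by simp
  qed
  have "continuous_on U D"
    using cont by (intro continuous_on_blinfun_componentwise) (simp cong: continuous_on_cong add: D)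
  then show ?thesis using D by (intro C1_onI)
qed

lemma C1_on_has_frechet_derivative:
  assumes "C1_on U f" "x \<in> U"
  shows "(f has_derivative frechet_derivative f (at x)) (at x)"
proof -
  have "f differentiable (at x)"
    using assms by (elim C1_onE) (rule differentiableI)
  then show ?thesis by (simp add: frechet_derivative_works)
qed

lemma C1_on_imp_continuous_on:
  assumes "C1_on U f"
  shows "continuous_on U f"
  by (rule has_derivative_continuous_on)
    (rule has_derivative_at_withinI[OF C1_on_has_frechet_derivative[OF assms]])

lemma C1_on_const: "C1_on U (\<lambda>x. c)"
  by (rule C1_onI[where D = "\<lambda>x. 0"]) (auto simp: zero_blinfun.rep_eq)

lemma C1_on_bounded_linear:
  assumes "bounded_linear g" shows "C1_on U g"
  by (rule C1_onI[where D = "\<lambda>x. Blinfun g"])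
    (auto simp: bounded_linear_Blinfun_apply assms bounded_linear_imp_has_derivative)

lemma C1_on_add:
  fixes f g :: "'a::euclidean_space \<Rightarrow> 'b::real_normed_vector"
  assumes "C1_on U f" "C1_on U g" shows "C1_on U (\<lambda>x. f x + g x)"
proof -
  obtain D E :: "'a \<Rightarrow> 'a \<Rightarrow>\<^sub>L 'b" where "\<And>x. x \<in> U \<Longrightarrow> (f has_derivative blinfun_apply (D x)) (at x)" "continuous_on U D"
    "\<And>x. x \<in> U \<Longrightarrow> (g has_derivative blinfun_apply (E x)) (at x)" "continuous_on U E"
    using assms by (auto elim!: C1_onE)
  then show ?thesis
    by (intro C1_onI[where D = "\<lambda>x. D x + E x"])
      (auto intro!: continuous_intros derivative_eq_intros simp: plus_blinfun.rep_eq)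
qed

lemma C1_on_mult:
  fixes f g :: "'a::euclidean_space \<Rightarrow> 'b::real_normed_algebra"
  assumes f: "C1_on U f" and g: "C1_on U g" shows "C1_on U (\<lambda>x. f x * g x)"
proof -
  obtain D E :: "'a \<Rightarrow> 'a \<Rightarrow>\<^sub>L 'b" where D: "\<And>x. x \<in> U \<Longrightarrow> (f has_derivative blinfun_apply (D x)) (at x)" "continuous_on U D"
    and E: "\<And>x. x \<in> U \<Longrightarrow> (g has_derivative blinfun_apply (E x)) (at x)" "continuous_on U E"
    using assms by (auto elim!: C1_onE)
  show ?thesis
  proof (rule C1_onI)
    show "((\<lambda>x. f x * g x) has_derivative
        blinfun_apply ((blinfun_mult_right (f x) o\<^sub>L E x) + (blinfun_mult_left (g x) o\<^sub>L D x))) (at x)"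
      if "x \<in> U" for x
      using D(1)[OF that] E(1)[OF that]
      by (auto intro!: derivative_eq_intros simp: plus_blinfun.rep_eq)
    show "continuous_on U (\<lambda>x. (blinfun_mult_right (f x) o\<^sub>L E x) + (blinfun_mult_left (g x) o\<^sub>L D x))"
      using D(2) E(2) C1_on_imp_continuous_on[OF f] C1_on_imp_continuous_on[OF g]
      by (intro continuous_intros bounded_linear.continuous_on[OF bounded_linear_blinfun_mult_right]
          bounded_linear.continuous_on[OF bounded_linear_blinfun_mult_left])
  qed
qed

lemma C1_on_power:
  fixes f :: "'a::euclidean_space \<Rightarrow> 'b::real_normed_algebra_1"
  shows "C1_on U f \<Longrightarrow> C1_on U (\<lambda>x. f x ^ n)"
  by (induction n) (auto intro: C1_on_const C1_on_mult)

lemma C1_on_prod: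
  fixes f :: "'i \<Rightarrow> 'a::euclidean_space \<Rightarrow> 'b::{real_normed_algebra_1, comm_ring_1}"
  shows "(\<And>i. i \<in> I \<Longrightarrow> C1_on U (f i)) \<Longrightarrow> C1_on U (\<lambda>x. \<Prod>i\<in>I. f i x)"
  by (induction I rule: infinite_finite_induct) (auto intro: C1_on_const C1_on_mult)

lemma C1_on_sum:
  "(\<And>i. i \<in> I \<Longrightarrow> C1_on U (f i)) \<Longrightarrow> C1_on U (\<lambda>x. \<Sum>i\<in>I. f i x)"
  by (induction I rule: infinite_finite_induct) (auto intro: C1_on_const C1_on_add)

lemma mixed_polynomial_C1:
  fixes f :: "complex ^ 'n \<Rightarrow> complex"
  assumes "mixed_polynomial f" shows "C1_on U f"
proof -
  have coord: "bounded_linear (\<lambda>z :: complex ^ 'n. z $ i)" for i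
    by (rule bounded_linear_vec_nth)
  have C1_coord: "C1_on U (\<lambda>z :: complex ^ 'n. z $ i)" for i
    by (rule C1_on_bounded_linear[OF coord])
  have C1_cnj: "C1_on U (\<lambda>z :: complex ^ 'n. cnj (z $ i))" for i
    by (rule C1_on_bounded_linear[OF bounded_linear_compose[OF bounded_linear_cnj coord]])
  show ?thesis
    using assms unfolding mixed_polynomial_def case_prod_unfold
    by (auto intro!: C1_on_sum C1_on_mult C1_on_prod C1_on_power C1_on_const C1_coord C1_cnj)
qed

section \<open>Tangent spaces of level sets and of submanifolds\<close>

lemma has_vector_derivative_chain:
  assumes "(\<gamma> has_vector_derivative v) (at t)" "(f has_derivative f') (at (\<gamma> t))"
  shows "((\<lambda>t. f (\<gamma> t)) has_vector_derivative f' v) (at t)"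
  using vector_derivative_diff_chain_within[OF assms(1) has_derivative_at_withinI[OF assms(2)]]
  by (simp add: o_def)

text \<open>Only the germ of the curve at time 0 matters, so the curve may be known to lie in \<open>M\<close> just
  eventually; this form composes well with continuity arguments.\<close>

lemma tangent_spaceI:
  assumes "\<gamma> 0 = p" "eventually (\<lambda>t. \<gamma> t \<in> M) (nhds 0)" "(\<gamma> has_vector_derivative v) (at 0)"
  shows "v \<in> tangent_space M p"
proof -
  obtain e where "e > 0" "\<And>t. dist t 0 < e \<Longrightarrow> \<gamma> t \<in> M"
    using assms(2) unfolding eventually_nhds_metric by blast
  then show ?thesis
    using assms(1,3) unfolding tangent_space_def by (auto simp: dist_real_def intro!: exI[of _ \<gamma>] exI[of _ e])
qed

lemma tangent_spaceE:
  assumes "v \<in> tangent_space M p"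
  obtains \<gamma> where "\<gamma> 0 = p" "eventually (\<lambda>t. \<gamma> t \<in> M) (nhds 0)" "(\<gamma> has_vector_derivative v) (at 0)"
proof -
  obtain \<gamma> e where "e > 0" "\<gamma> 0 = p" "\<forall>t\<in>{-e<..<e}. \<gamma> t \<in> M" "(\<gamma> has_vector_derivative v) (at 0)"
    using assms unfolding tangent_space_def by blast
  moreover from this have "eventually (\<lambda>t. \<gamma> t \<in> M) (nhds 0)"
    by (intro eventually_mono[OF eventually_nhds_in_open[of "{-e<..<e}"]]) auto
  ultimately show ?thesis using that by blast
qed

text \<open>That velocities of curves in a level set are in the kernel is the chain rule. For the converse,
  write \<open>D\<close> for the derivative at \<open>z\<close> and \<open>S\<close> for a linear right inverse of it, and consider
  \<open>G x = x - S (D x) + S (f x)\<close>. Its derivative at \<open>z\<close> is the identity, so it has a local inverse \<open>g\<close>,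
  and \<open>D (G x) = f x\<close>, so \<open>g\<close> straightens the level sets of \<open>f\<close> into translates of the kernel of \<open>D\<close>.
  The curve \<open>g (G z + t v)\<close> with \<open>v\<close> in the kernel therefore stays in the fiber.\<close>

lemma tangent_space_level_set:
  fixes f :: "'a::euclidean_space \<Rightarrow> 'b::euclidean_space"
  assumes C1: "C1_on UNIV f" and surj: "surj (frechet_derivative f (at z))"
  shows "tangent_space (f -` {f z}) z = {v. frechet_derivative f (at z) v = 0}"
proof -
  obtain D :: "'a \<Rightarrow> 'a \<Rightarrow>\<^sub>L 'b" where D: "\<And>x. (f has_derivative blinfun_apply (D x)) (at x)" and cont: "continuous_on UNIV D"
    using C1_onE[OF C1] by auto
  have f': "frechet_derivative f (at z) = blinfun_apply (D z)"
    by (rule frechet_derivative_at[OF D, symmetric])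
  have linD: "linear (blinfun_apply (D z))"
    by (simp add: bounded_linear.linear blinfun.bounded_linear_right)
  obtain h where h: "linear h" "blinfun_apply (D z) \<circ> h = id"
    using linear_surjective_right_inverse[OF linD] surj unfolding f' by auto
  define S where "S = Blinfun h"
  have S: "D z (S u) = u" for u
    using h by (simp add: S_def bounded_linear_Blinfun_apply linear_conv_bounded_linear fun_eq_iff)
  define G where "G x = x - S (D z x) + S (f x)" for x
  define G' where "G' x = id_blinfun - (S o\<^sub>L D z) + (S o\<^sub>L D x)" for x
  have G: "(G has_derivative blinfun_apply (G' x)) (at x)" for x
    unfolding G_def G'_def
    by (auto intro!: derivative_eq_intros D simp: blinfun.bilinear_simps)
  have contG': "continuous_on UNIV G'"
    unfolding G'_def by (intro continuous_intros cont)
  have G'z: "G' z = id_blinfun"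
    by (simp add: G'_def)
  have D_G: "D z (G x) = f x" for x
    by (simp add: G_def blinfun.bilinear_simps S)
  have "id_blinfun o\<^sub>L G' z = id_blinfun"
    by (intro blinfun_eqI) (simp add: G'z)
  then obtain U V g g' where V: "open V" "G z \<in> V" and U: "z \<in> U" and hom: "homeomorphism U V G g"
    and g: "\<And>y. y \<in> V \<Longrightarrow> (g has_derivative (g' y)) (at y)"
    and g': "\<And>y. y \<in> V \<Longrightarrow> g' y = inv (blinfun_apply (G' (g y)))"
    using inverse_function_theorem[OF open_UNIV G contG' UNIV_I, of id_blinfun z] by metis
  have gG: "g (G z) = z" and Gg: "\<And>y. y \<in> V \<Longrightarrow> G (g y) = y"
    using hom U by (auto simp: homeomorphism_def)
  have "g' (G z) = id"
    using g'[OF V(2)] by (simp add: gG G'z inv_unique_comp fun_eq_iff)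
  then have g_deriv: "(g has_derivative id) (at (G z))"
    using g[OF V(2)] by simp
  show ?thesis
  proof (intro equalityI subsetI CollectI)
    fix v assume "v \<in> tangent_space (f -` {f z}) z"
    then obtain \<gamma> where \<gamma>: "\<gamma> 0 = z" "eventually (\<lambda>t. \<gamma> t \<in> f -` {f z}) (nhds 0)"
      "(\<gamma> has_vector_derivative v) (at 0)"
      by (rule tangent_spaceE)
    have "((\<lambda>t. f (\<gamma> t)) has_vector_derivative D z v) (at 0)"
      using has_vector_derivative_chain[OF \<gamma>(3)] D \<gamma>(1) by blast
    moreover have "((\<lambda>t. f (\<gamma> t)) has_vector_derivative D z v) (at 0) \<longleftrightarrow>
        ((\<lambda>t::real. f z) has_vector_derivative D z v) (at 0)"
      using \<gamma>(1,2) by (intro has_vector_derivative_cong_ev) (auto elim: eventually_mono)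
    ultimately have "((\<lambda>t::real. f z) has_vector_derivative D z v) (at 0)"
      by blast
    then have "D z v = 0"
      using has_vector_derivative_const by (rule vector_derivative_unique_at)
    then show "frechet_derivative f (at z) v = 0"
      by (simp add: f')
  next
    fix v assume "v \<in> {v. frechet_derivative f (at z) v = 0}"
    then have v: "D z v = 0" by (simp add: f')
    define \<gamma> where "\<gamma> t = g (G z + t *\<^sub>R v)" for t
    show "v \<in> tangent_space (f -` {f z}) z"
    proof (rule tangent_spaceI)
      show "\<gamma> 0 = z" by (simp add: \<gamma>_def gG)
      have "((\<lambda>t. G z + t *\<^sub>R v) \<longlongrightarrow> G z + 0 *\<^sub>R v) (nhds 0)"
        by (intro tendsto_intros filterlim_ident)
      then have "eventually (\<lambda>t. G z + t *\<^sub>R v \<in> V) (nhds 0)"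
        using V by (auto dest!: topological_tendstoD)
      then show "eventually (\<lambda>t. \<gamma> t \<in> f -` {f z}) (nhds 0)"
      proof eventually_elim
        case (elim t)
        have "f (\<gamma> t) = D z (G z + t *\<^sub>R v)"
          using D_G[of "\<gamma> t"] Gg[OF elim] by (simp add: \<gamma>_def)
        also have "\<dots> = f z" by (simp add: blinfun.bilinear_simps v D_G)
        finally show ?case by simp
      qed
      show "(\<gamma> has_vector_derivative v) (at 0)"
      proof -
        have "((\<lambda>t. G z + t *\<^sub>R v) has_vector_derivative v) (at 0)"
          by (auto intro!: derivative_eq_intros simp: has_vector_derivative_def)
        from has_vector_derivative_chain[OF this, of g id] g_deriv show ?thesis
          by (simp add: \<gamma>_def[abs_def])
      qed
    qed
  qed
qed

text \<open>The range of a linear right inverse is a complement of the kernel.\<close>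

lemma dim_kernel_surjective:
  fixes h :: "'a::euclidean_space \<Rightarrow> 'b::euclidean_space"
  assumes h: "linear h" and surj: "surj h"
  shows "dim {v. h v = 0} = DIM('a) - DIM('b)"
proof -
  obtain g where g: "linear g" "h \<circ> g = id"
    using linear_surjective_right_inverse[OF h surj] by blast
  have hg: "h (g y) = y" for y using g(2) by (simp add: fun_eq_iff)
  have K: "subspace {v. h v = 0}" by (rule linear_subspace_kernel[OF h])
  have R: "subspace (range g)" by (rule linear_subspace_image[OF g(1)]) simp
  have "inj g" by (rule inj_on_inverseI[of _ h]) (rule hg)
  then have dimR: "dim (range g) = DIM('b)"
    by (simp add: dim_image_eq g(1))
  have "{u + v |u v. u \<in> {v. h v = 0} \<and> v \<in> range g} = UNIV"
  proof (intro equalityI subset_UNIV subsetI)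
    fix x
    have "x = (x - g (h x)) + g (h x)" "h (x - g (h x)) = 0"
      by (simp_all add: linear_diff[OF h] hg)
    then show "x \<in> {u + v |u v. u \<in> {v. h v = 0} \<and> v \<in> range g}" by blast
  qed
  moreover have "{v. h v = 0} \<inter> range g = {0}"
    using linear_0[OF g(1)] linear_0[OF h] by (auto simp: hg)
  ultimately have "DIM('a) + 0 = dim {v. h v = 0} + dim (range g)"
    using dim_sums_Int[OF K R] by simp
  then show ?thesis using dimR by simp
qed

lemma tangent_space_level_set_in_grassmannian:
  fixes f :: "'a::euclidean_space \<Rightarrow> 'b::euclidean_space"
  assumes C1: "C1_on UNIV f" and surj: "surj (frechet_derivative f (at z))"
  shows "tangent_space (f -` {f z}) z \<in> grassmannian (DIM('a) - DIM('b))"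
proof -
  have lin: "linear (frechet_derivative f (at z))"
    using C1_on_has_frechet_derivative[OF C1] by (rule has_derivative_linear) simp
  show ?thesis
    unfolding tangent_space_level_set[OF assms] grassmannian_def
    using dim_kernel_surjective[OF lin surj] linear_subspace_kernel[OF lin] by simp
qed

lemma not_critical_point_surj:
  fixes f :: "'a::euclidean_space \<Rightarrow> complex"
  assumes C1: "C1_on UNIV f" and z: "\<not> critical_point f z"
  shows "surj (frechet_derivative f (at z))"
proof -
  let ?A = "frechet_derivative f (at z)"
  have "linear ?A"
    using C1_on_has_frechet_derivative[OF C1] by (rule has_derivative_linear) simp
  then have "subspace (range ?A)" by (rule linear_subspace_image) simp
  moreover have "dim (range ?A) = DIM(complex)"
    using z dim_subset_UNIV[of "range ?A"] unfolding critical_point_def by simp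
  ultimately show ?thesis using dim_eq_full span_eq_iff by metis
qed

text \<open>The sphere is a level set of the squared norm, which is regular away from the origin.\<close>

lemma tangent_space_sphere:
  fixes z :: "'a::euclidean_space"
  assumes z: "z \<noteq> 0"
  shows "tangent_space (sphere 0 (norm z)) z = {v. v \<bullet> z = 0}"
proof -
  define q :: "'a \<Rightarrow> real" where "q x = x \<bullet> x" for x
  define D :: "'a \<Rightarrow> 'a \<Rightarrow>\<^sub>L real" where "D x = 2 *\<^sub>R blinfun_inner_left x" for x
  have q': "(q has_derivative blinfun_apply (D x)) (at x)" for x
    unfolding q_def[abs_def] D_def
    by (auto intro!: derivative_eq_intros simp: scaleR_blinfun.rep_eq inner_commute)
  have D: "frechet_derivative q (at x) = blinfun_apply (D x)" for x
    by (rule frechet_derivative_at[OF q', symmetric])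
  have "continuous_on UNIV D"
    unfolding D_def
    by (intro continuous_intros bounded_linear.continuous_on[OF bounded_linear_blinfun_inner_left])
  then have C1: "C1_on UNIV q" using q' by (intro C1_onI) auto
  have "\<exists>v. y = D z v" for y
    using z by (intro exI[of _ "(y / (2 * (z \<bullet> z))) *\<^sub>R z"]) (simp add: D_def scaleR_blinfun.rep_eq)
  then have surj: "surj (frechet_derivative q (at z))" unfolding D by (auto simp: surj_def)
  have "sphere 0 (norm z) = q -` {q z}"
    by (auto simp: q_def norm_eq_sqrt_inner)
  then show ?thesis
    using tangent_space_level_set[OF C1 surj] unfolding D
    by (simp add: D_def scaleR_blinfun.rep_eq)
qed

text \<open>The tangent space of the sphere is a hyperplane, so a single vector off it suffices.\<close>

lemma transverse_at_sphereI:
  fixes z :: "'a::euclidean_space"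
  assumes T: "subspace (tangent_space N z)" and u: "u \<in> tangent_space N z" "u \<bullet> z \<noteq> 0"
  shows "transverse_at N (sphere 0 (norm z)) z"
  unfolding transverse_at_def
proof (intro equalityI subset_UNIV subsetI)
  fix x
  have "z \<noteq> 0" using u by auto
  let ?c = "(x \<bullet> z) / (u \<bullet> z)"
  have "?c *\<^sub>R u \<in> tangent_space N z" using T u by (simp add: subspace_scale)
  moreover have "x - ?c *\<^sub>R u \<in> tangent_space (sphere 0 (norm z)) z"
    unfolding tangent_space_sphere[OF \<open>z \<noteq> 0\<close>] using u by (simp add: inner_diff_left)
  moreover have "x = ?c *\<^sub>R u + (x - ?c *\<^sub>R u)" by simp
  ultimately show "x \<in> {u + v |u v. u \<in> tangent_space N z \<and> v \<in> tangent_space (sphere 0 (norm z)) z}"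
    by blast
qed

text \<open>The component of the curve orthogonal to \<open>L\<close> vanishes near time 0, hence so does its velocity.\<close>

lemma velocity_in_subspace:
  fixes c :: "real \<Rightarrow> 'a::euclidean_space"
  assumes c: "(c has_vector_derivative w) (at 0)"
    and L: "subspace L" and ev: "eventually (\<lambda>t. c t \<in> L) (nhds 0)"
  shows "w \<in> L"
proof -
  let ?Q = "\<lambda>x. x - closest_point L x"
  have Q: "bounded_linear ?Q"
    by (intro bounded_linear_sub bounded_linear_ident bounded_linear_closest_point_subspace L)
  have "((\<lambda>t. ?Q (c t)) has_vector_derivative ?Q w) (at 0)"
    by (rule bounded_linear.has_vector_derivative[OF Q c])
  moreover have "((\<lambda>t. ?Q (c t)) has_vector_derivative ?Q w) (at 0) \<longleftrightarrow>
      ((\<lambda>t::real. 0) has_vector_derivative ?Q w) (at 0)"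
  proof (rule has_vector_derivative_cong_ev)
    show "eventually (\<lambda>t. t \<in> UNIV \<longrightarrow> ?Q (c t) = 0) (nhds 0)"
      using ev by (rule eventually_mono) (simp add: closest_point_self)
    show "?Q (c 0) = 0"
      using eventually_nhds_x_imp_x[OF ev] by (simp add: closest_point_self)
  qed
  ultimately have "((\<lambda>t::real. 0) has_vector_derivative ?Q w) (at 0)"
    by blast
  then have "?Q w = 0"
    using has_vector_derivative_const by (rule vector_derivative_unique_at)
  then show "w \<in> L"
    using closest_point_subspace_in[OF L, of w] by simp
qed

text \<open>A chart as in \<open>smooth_submanifold\<close>, but of class \<open>C\<^sup>1\<close>: this is the regularity that makes the
  tangent spaces of \<open>M\<close> vary continuously.\<close>

definition slice_chart ::
    "'a::euclidean_space set \<Rightarrow> 'a set \<Rightarrow> 'a set \<Rightarrow> ('a \<Rightarrow> 'a) \<Rightarrow> ('a \<Rightarrow> 'a) \<Rightarrow> 'a set \<Rightarrow> bool" where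
  "slice_chart M U V \<phi> \<psi> L \<longleftrightarrow> open U \<and> open V \<and> homeomorphism U V \<phi> \<psi> \<and>
     C1_on U \<phi> \<and> C1_on V \<psi> \<and> subspace L \<and> \<phi> ` (U \<inter> M) = V \<inter> L"

lemma smooth_submanifold_slice_chart:
  assumes "smooth_submanifold d M" "p \<in> M"
  obtains U V \<phi> \<psi> L where "slice_chart M U V \<phi> \<psi> L" "p \<in> U" "dim L = d"
  using assms smooth_on_imp_C1_on unfolding smooth_submanifold_def slice_chart_def by metis

text \<open>A straight line through \<open>\<phi> p\<close> inside the slice is carried by \<open>\<psi>\<close> to a curve in \<open>M\<close>.\<close>

lemma slice_chart_curve:
  assumes chart: "slice_chart M U V \<phi> \<psi> L" and p: "p \<in> U" "p \<in> M" and v: "v \<in> L"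
  shows "frechet_derivative \<psi> (at (\<phi> p)) v \<in> tangent_space M p"
proof (rule tangent_spaceI)
  have V: "open V" and hom: "homeomorphism U V \<phi> \<psi>" and C1: "C1_on V \<psi>" and L: "subspace L"
    and slice: "\<phi> ` (U \<inter> M) = V \<inter> L"
    using chart by (auto simp: slice_chart_def)
  have \<phi>p: "\<phi> p \<in> V" "\<phi> p \<in> L" using slice p by auto
  have \<psi>\<phi>: "\<psi> (\<phi> x) = x" if "x \<in> U" for x
    using hom that by (auto simp: homeomorphism_def)
  let ?\<gamma> = "\<lambda>t::real. \<psi> (\<phi> p + t *\<^sub>R v)"
  show "?\<gamma> 0 = p" using \<psi>\<phi> p by simp
  have "((\<lambda>t. \<phi> p + t *\<^sub>R v) \<longlongrightarrow> \<phi> p + 0 *\<^sub>R v) (nhds 0)"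
    by (intro tendsto_intros filterlim_ident)
  then have "eventually (\<lambda>t. \<phi> p + t *\<^sub>R v \<in> V) (nhds 0)"
    using V \<phi>p by (auto dest!: topological_tendstoD)
  then show "eventually (\<lambda>t. ?\<gamma> t \<in> M) (nhds 0)"
  proof eventually_elim
    case (elim t)
    then have "\<phi> p + t *\<^sub>R v \<in> \<phi> ` (U \<inter> M)"
      unfolding slice using \<phi>p v L by (simp add: subspace_add subspace_scale)
    then show ?case using \<psi>\<phi> by force
  qed
  have "((\<lambda>t. \<phi> p + t *\<^sub>R v) has_vector_derivative v) (at 0)"
    by (auto intro!: derivative_eq_intros simp: has_vector_derivative_def)
  then show "(?\<gamma> has_vector_derivative frechet_derivative \<psi> (at (\<phi> p)) v) (at 0)"
    using has_vector_derivative_chain C1_on_has_frechet_derivative[OF C1 \<phi>p(1)]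
    by fastforce
qed

lemma slice_chart_tangent_space:
  assumes chart: "slice_chart M U V \<phi> \<psi> L" and p: "p \<in> U" "p \<in> M"
  shows "tangent_space M p = frechet_derivative \<psi> (at (\<phi> p)) ` L"
    and "inj (frechet_derivative \<psi> (at (\<phi> p)))"
proof -
  let ?A = "frechet_derivative \<phi> (at p)" and ?B = "frechet_derivative \<psi> (at (\<phi> p))"
  have U: "open U" and V: "open V" and hom: "homeomorphism U V \<phi> \<psi>"
    and C1: "C1_on U \<phi>" "C1_on V \<psi>" and L: "subspace L" and slice: "\<phi> ` (U \<inter> M) = V \<inter> L"
    using chart by (auto simp: slice_chart_def)
  have \<phi>p: "\<phi> p \<in> V" using slice p by auto
  have \<psi>\<phi>: "\<psi> (\<phi> x) = x" if "x \<in> U" for x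
    using hom that by (auto simp: homeomorphism_def)
  have \<phi>\<psi>: "\<phi> (\<psi> y) = y" if "y \<in> V" for y
    using hom that by (auto simp: homeomorphism_def)
  have A: "(\<phi> has_derivative ?A) (at p)" and B: "(\<psi> has_derivative ?B) (at (\<phi> p))"
    using C1 p \<phi>p by (auto intro: C1_on_has_frechet_derivative)
  have "(\<psi> \<circ> \<phi> has_derivative ?B \<circ> ?A) (at p)"
    by (rule diff_chain_at[OF A B])
  then have "((\<lambda>x. x) has_derivative ?B \<circ> ?A) (at p)"
    by (rule has_derivative_transform_within_open[OF _ U p(1)]) (simp add: \<psi>\<phi>)
  then have BA: "?B \<circ> ?A = (\<lambda>x. x)"
    using has_derivative_ident by (rule has_derivative_unique)
  have "(\<phi> \<circ> \<psi> has_derivative ?A \<circ> ?B) (at (\<phi> p))"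
    by (rule diff_chain_at[OF B]) (simp add: \<psi>\<phi> p A)
  then have "((\<lambda>x. x) has_derivative ?A \<circ> ?B) (at (\<phi> p))"
    by (rule has_derivative_transform_within_open[OF _ V \<phi>p]) (simp add: \<phi>\<psi>)
  then have AB: "?A \<circ> ?B = (\<lambda>x. x)"
    using has_derivative_ident by (rule has_derivative_unique)
  show "inj ?B"
    by (rule inj_on_inverseI[of _ ?A]) (use AB in \<open>simp add: fun_eq_iff\<close>)
  show "tangent_space M p = ?B ` L"
  proof (intro equalityI subsetI)
    fix v assume "v \<in> tangent_space M p"
    then obtain \<gamma> where \<gamma>: "\<gamma> 0 = p" "eventually (\<lambda>t. \<gamma> t \<in> M) (nhds 0)"
      "(\<gamma> has_vector_derivative v) (at 0)"
      by (rule tangent_spaceE)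
    have vd: "((\<lambda>t. \<phi> (\<gamma> t)) has_vector_derivative ?A v) (at 0)"
      using \<gamma>(1) A by (intro has_vector_derivative_chain[OF \<gamma>(3)]) simp
    have "(\<gamma> \<longlongrightarrow> \<gamma> 0) (nhds 0)"
      using has_vector_derivative_continuous[OF \<gamma>(3)] isCont_def tendsto_at_iff_tendsto_nhds by blast
    then have "eventually (\<lambda>t. \<gamma> t \<in> U) (nhds 0)"
      using U p \<gamma>(1) by (auto dest!: topological_tendstoD)
    with \<gamma>(2) have "eventually (\<lambda>t. \<phi> (\<gamma> t) \<in> L) (nhds 0)"
      by eventually_elim (use slice in blast)
    then have "?A v \<in> L"
      by (rule velocity_in_subspace[OF vd L])
    moreover have "v = ?B (?A v)"
      using BA by (simp add: fun_eq_iff)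
    ultimately show "v \<in> ?B ` L" by blast
  next
    fix v assume "v \<in> ?B ` L"
    then show "v \<in> tangent_space M p"
      using slice_chart_curve[OF chart p] by blast
  qed
qed

lemma tangent_space_in_grassmannian:
  assumes M: "smooth_submanifold d M" and p: "p \<in> M"
  shows "tangent_space M p \<in> grassmannian d"
proof -
  obtain U V \<phi> \<psi> L where chart: "slice_chart M U V \<phi> \<psi> L" and pU: "p \<in> U" and d: "dim L = d"
    using smooth_submanifold_slice_chart[OF M p] .
  let ?B = "frechet_derivative \<psi> (at (\<phi> p))"
  have L: "subspace L" and C1: "C1_on V \<psi>" and \<phi>p: "\<phi> p \<in> V"
    using chart pU p by (auto simp: slice_chart_def)
  have lin: "linear ?B"
    using C1_on_has_frechet_derivative[OF C1 \<phi>p] by (rule has_derivative_linear)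
  have "inj_on ?B (span L)"
    using slice_chart_tangent_space(2)[OF chart pU p] by (rule inj_on_subset) simp
  then show ?thesis
    unfolding grassmannian_def slice_chart_tangent_space(1)[OF chart pU p]
    using L d lin by (simp add: dim_image_eq linear_subspace_image)
qed

section \<open>Small spheres, strata and nearby fibers\<close>

text \<open>In the chart, join \<open>\<phi> p\<close> to \<open>\<phi> w\<close> by a segment of the slice; its image under \<open>\<psi>\<close> is a curve in \<open>M\<close>
  from \<open>p\<close> to \<open>w\<close> with velocity \<open>v = D\<psi> (\<phi> w) (\<phi> w - \<phi> p)\<close> at \<open>w\<close>. Since \<open>\<psi>\<close> is \<open>C\<^sup>1\<close>, the error
  \<open>(w - p) - v\<close> is \<open>o(norm (\<phi> w - \<phi> p)) = o(norm (w - p))\<close>, and a vector closer to \<open>w - p\<close> than the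
  origin is cannot be orthogonal to \<open>w - p\<close>.\<close>

lemma submanifold_radial_tangent_vector:
  assumes M: "smooth_submanifold d M" and p: "p \<in> M"
  obtains \<rho> where "\<rho> > 0"
    "\<And>w. w \<in> M \<Longrightarrow> w \<noteq> p \<Longrightarrow> dist w p < \<rho> \<Longrightarrow> \<exists>v\<in>tangent_space M w. v \<bullet> (w - p) \<noteq> 0"
proof -
  obtain U V \<phi> \<psi> L where chart: "slice_chart M U V \<phi> \<psi> L" and pU: "p \<in> U"
    using smooth_submanifold_slice_chart[OF M p] .
  have U: "open U" and V: "open V" and hom: "homeomorphism U V \<phi> \<psi>"
    and C1: "C1_on U \<phi>" "C1_on V \<psi>" and L: "subspace L" and slice: "\<phi> ` (U \<inter> M) = V \<inter> L"
    using chart by (auto simp: slice_chart_def)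
  have \<phi>: "\<phi> w \<in> V \<and> \<phi> w \<in> L" if "w \<in> U" "w \<in> M" for w using slice that by auto
  have \<psi>\<phi>: "\<psi> (\<phi> x) = x" if "x \<in> U" for x
    using hom that by (auto simp: homeomorphism_def)
  let ?b = "\<phi> p"
  obtain D :: "'a \<Rightarrow> 'a \<Rightarrow>\<^sub>L 'a" where
    D: "\<And>x. x \<in> V \<Longrightarrow> (\<psi> has_derivative blinfun_apply (D x)) (at x)" and contD: "continuous_on V D"
    using C1_onE[OF C1(2)] by auto
  let ?A = "frechet_derivative \<phi> (at p)"
  have A: "(\<phi> has_derivative ?A) (at p)"
    by (rule C1_on_has_frechet_derivative[OF C1(1) pU])
  define C where "C = onorm ?A + 1"
  have C: "C > 0"
    using onorm_pos_le[OF has_derivative_bounded_linear[OF A]] by (simp add: C_def)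
  obtain d1 where d1: "d1 > 0"
    "\<And>w. norm (w - p) < d1 \<Longrightarrow> norm (\<phi> w - ?b - ?A (w - p)) \<le> 1 * norm (w - p)"
  proof -
    have "\<exists>d>0. \<forall>w. norm (w - p) < d \<longrightarrow> norm (\<phi> w - ?b - ?A (w - p)) \<le> 1 * norm (w - p)"
      using A unfolding has_derivative_at_alt by (auto simp only: zero_less_one)
    then show ?thesis using that by auto
  qed
  have lip: "norm (\<phi> w - ?b) \<le> C * norm (w - p)" if "norm (w - p) < d1" for w
  proof -
    have "norm (\<phi> w - ?b) \<le> norm (\<phi> w - ?b - ?A (w - p)) + norm (?A (w - p))"
      using norm_triangle_ineq[of "\<phi> w - ?b - ?A (w - p)" "?A (w - p)"] by simp
    also have "\<dots> \<le> norm (w - p) + onorm ?A * norm (w - p)"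
      using d1(2)[OF that] onorm[OF has_derivative_bounded_linear[OF A], of "w - p"] by simp
    finally show ?thesis by (simp add: C_def algebra_simps)
  qed
  \<comment> \<open>Two error terms of size \<open>\<epsilon> * norm (\<phi> w - \<phi> p)\<close> will arise, and \<open>2 * \<epsilon> * C < 1\<close>.\<close>
  define \<epsilon> where "\<epsilon> = 1 / (3 * C)"
  have \<epsilon>: "\<epsilon> > 0" using C by (simp add: \<epsilon>_def)
  have bV: "?b \<in> V" using \<phi> pU p by blast
  obtain d2 where d2: "d2 > 0"
    "\<And>a. norm (a - ?b) < d2 \<Longrightarrow> norm (\<psi> a - \<psi> ?b - D ?b (a - ?b)) \<le> \<epsilon> * norm (a - ?b)"
  proof -
    have "\<exists>d>0. \<forall>a. norm (a - ?b) < d \<longrightarrow> norm (\<psi> a - \<psi> ?b - D ?b (a - ?b)) \<le> \<epsilon> * norm (a - ?b)"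
      using D[OF bV] \<epsilon> unfolding has_derivative_at_alt by (auto simp only:)
    then show ?thesis using that by auto
  qed
  obtain d3 where d3: "d3 > 0" "\<And>a. a \<in> V \<Longrightarrow> dist a ?b < d3 \<Longrightarrow> dist (D a) (D ?b) < \<epsilon>"
  proof -
    have "\<exists>d>0. \<forall>a\<in>V. dist a ?b < d \<longrightarrow> dist (D a) (D ?b) < \<epsilon>"
      using contD bV \<epsilon> unfolding continuous_on_iff by (auto simp only:)
    then show ?thesis using that by auto
  qed
  obtain d4 where d4: "d4 > 0" "ball p d4 \<subseteq> U"
    using U pU open_contains_ball by blast
  define \<rho> where "\<rho> = Min {d1, d2 / C, d3 / C, d4}"
  show ?thesis
  proof (rule that)
    show "\<rho> > 0" using d1 d2 d3 d4 C by (simp add: \<rho>_def)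
    fix w assume w: "w \<in> M" "w \<noteq> p" "dist w p < \<rho>"
    then have wU: "w \<in> U" using d4(2) by (auto simp: \<rho>_def dist_commute)
    have near: "norm (w - p) < d1" "C * norm (w - p) < d2" "C * norm (w - p) < d3"
      using w(3) C by (auto simp: \<rho>_def dist_norm field_simps)
    let ?a = "\<phi> w"
    have a: "norm (?a - ?b) < d2" "norm (?a - ?b) < d3" "?a \<in> V"
      using lip[OF near(1)] near \<phi> wU w by auto
    let ?v = "D ?a (?a - ?b)"
    have "?a - ?b \<in> L" using \<phi> wU w(1) pU p L by (simp add: subspace_diff)
    then have v: "?v \<in> tangent_space M w"
      using slice_chart_curve[OF chart wU w(1)] frechet_derivative_at[OF D[OF a(3)]] by metis
    \<comment> \<open>Compare with the derivative at \<open>?b\<close>, where the Taylor estimate is available, and pay for moving it to \<open>?a\<close>.\<close>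
    have "norm ((w - p) - ?v) =
        norm ((\<psi> ?a - \<psi> ?b - D ?b (?a - ?b)) - (D ?a - D ?b) (?a - ?b))"
      by (simp add: \<psi>\<phi> wU pU minus_blinfun.rep_eq)
    also have "\<dots> \<le> norm (\<psi> ?a - \<psi> ?b - D ?b (?a - ?b)) + norm ((D ?a - D ?b) (?a - ?b))"
      by (rule norm_triangle_ineq4)
    also have "\<dots> \<le> \<epsilon> * norm (?a - ?b) + \<epsilon> * norm (?a - ?b)"
    proof (rule add_mono)
      have "norm ((D ?a - D ?b) (?a - ?b)) \<le> norm (D ?a - D ?b) * norm (?a - ?b)"
        by (rule norm_blinfun)
      also have "\<dots> \<le> \<epsilon> * norm (?a - ?b)"
        using d3(2)[OF a(3)] a(2) by (intro mult_right_mono) (auto simp: dist_norm)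
      finally show "norm ((D ?a - D ?b) (?a - ?b)) \<le> \<epsilon> * norm (?a - ?b)" .
    qed (rule d2(2)[OF a(1)])
    also have "\<dots> \<le> 2 * \<epsilon> * (C * norm (w - p))"
      using lip[OF near(1)] \<epsilon> by simp
    also have "\<dots> < norm (w - p)"
      using C w(2) by (simp add: \<epsilon>_def)
    finally have close: "norm ((w - p) - ?v) < norm (w - p)" .
    have pythagoras: "(norm (x - y))\<^sup>2 = (norm x)\<^sup>2 + (norm y)\<^sup>2" if "y \<bullet> x = 0" for x y :: 'a
      using that by (simp add: power2_norm_eq_inner inner_diff inner_commute)
    have "?v \<bullet> (w - p) \<noteq> 0"
    proof
      assume "?v \<bullet> (w - p) = 0"
      then have "(norm ((w - p) - ?v))\<^sup>2 = (norm (w - p))\<^sup>2 + (norm ?v)\<^sup>2"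
        by (intro pythagoras)
      then have "(norm (w - p))\<^sup>2 \<le> (norm ((w - p) - ?v))\<^sup>2" by simp
      then have "norm (w - p) \<le> norm ((w - p) - ?v)"
        by (rule power2_le_imp_le) simp
      then show False using close by simp
    qed
    then show "\<exists>v\<in>tangent_space M w. v \<bullet> (w - p) \<noteq> 0" using v by blast
  qed
qed

text \<open>Otherwise there are points \<open>x n \<longlonglongrightarrow> p\<close> of \<open>X\<close> at which the secant direction \<open>x n - p\<close> is orthogonal to
  the tangent space of \<open>X\<close>. After passing to a subsequence the tangent spaces tend to some \<open>\<tau>\<close> and the
  secant lines to some line \<open>l\<close>. The limit of the orthogonality relations makes \<open>l\<close> orthogonal to \<open>\<tau>\<close>,
  while condition (b), applied with the constant sequence \<open>p\<close> in \<open>Y\<close>, puts \<open>l\<close> inside \<open>\<tau>\<close>.\<close>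

lemma whitney_b_radial_tangent_vector:
  assumes X: "smooth_submanifold d X" and b: "whitney_b X Y" and p: "p \<in> Y"
  obtains \<rho> where "\<rho> > 0"
    "\<And>w. w \<in> X \<Longrightarrow> w \<noteq> p \<Longrightarrow> dist w p < \<rho> \<Longrightarrow> \<exists>v\<in>tangent_space X w. v \<bullet> (w - p) \<noteq> 0"
proof (rule ccontr)
  assume "\<not> thesis"
  then have "\<exists>w. w \<in> X \<and> w \<noteq> p \<and> dist w p < inverse (real (Suc n)) \<and>
      (\<forall>v\<in>tangent_space X w. v \<bullet> (w - p) = 0)" for n
    using that[of "inverse (real (Suc n))"] by auto
  then obtain x where x: "\<And>n. x n \<in> X" "\<And>n. x n \<noteq> p"
    and dist: "\<And>n. dist (x n) p < inverse (real (Suc n))"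
    and orth: "\<And>n v. v \<in> tangent_space X (x n) \<Longrightarrow> v \<bullet> (x n - p) = 0"
    by metis
  have lim: "x \<longlonglongrightarrow> p"
  proof (rule metric_tendsto_imp_tendsto[OF LIMSEQ_inverse_real_of_nat], intro always_eventually allI)
    show "dist (x n) p \<le> dist (inverse (real (Suc n))) 0" for n
      using dist[of n] by simp
  qed
  define u where "u n = (x n - p) /\<^sub>R norm (x n - p)" for n
  have norm_u: "norm (u n) = 1" for n using x(2) by (simp add: u_def)
  have secant: "span {x n - p} \<in> grassmannian 1" for n
    using x(2) by (simp add: grassmannian_def)
  obtain s1 \<tau> where s1: "strict_mono s1" and \<tau>: "grassmannian_lim d ((\<lambda>n. tangent_space X (x n)) \<circ> s1) \<tau>"
    using grassmannian_compact[of "\<lambda>n. tangent_space X (x n)"] tangent_space_in_grassmannian[OF X x(1)]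
    by blast
  have secant_s1: "((\<lambda>n. span {x n - p}) \<circ> s1) i \<in> grassmannian 1" for i
    using secant by (simp only: o_def)
  obtain s2 l where s2: "strict_mono s2" and l: "grassmannian_lim 1 ((\<lambda>n. span {x n - p}) \<circ> s1 \<circ> s2) l"
    using grassmannian_compact[OF secant_s1] .
  have "bounded (range (u \<circ> s1 \<circ> s2))"
    using norm_u by (auto simp: bounded_iff intro!: exI[of _ 1])
  then obtain s3 a where s3: "strict_mono (s3 :: nat \<Rightarrow> nat)" and a: "(u \<circ> s1 \<circ> s2 \<circ> s3) \<longlonglongrightarrow> a"
    using bounded_imp_convergent_subsequence by blast
  define s where "s = s1 \<circ> s2 \<circ> s3"
  have s: "strict_mono s" unfolding s_def by (intro strict_mono_o s1 s2 s3)
  have \<tau>': "grassmannian_lim d (\<lambda>n. tangent_space X (x (s n))) \<tau>"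
    using grassmannian_lim_subseq[OF grassmannian_lim_subseq[OF \<tau> s2] s3] by (simp add: s_def o_def)
  have l': "grassmannian_lim 1 (\<lambda>n. span {x (s n) - p}) l"
    using grassmannian_lim_subseq[OF l s3] by (simp add: s_def o_def)
  have a': "(\<lambda>n. u (s n)) \<longlonglongrightarrow> a" using a by (simp add: s_def o_def)
  have lim': "(\<lambda>n. x (s n)) \<longlonglongrightarrow> p"
    using LIMSEQ_subseq_LIMSEQ[OF lim s] by (simp add: o_def)
  have "l \<subseteq> \<tau>"
    using b[unfolded whitney_b_def, rule_format, of "\<lambda>n. x (s n)" "\<lambda>n. p" p d \<tau> l]
      x(1) p lim' \<tau>' l' by simp
  moreover have "a \<in> l"
  proof (rule grassmannian_lim_mem[OF l' _ a'])
    show "u (s n) \<in> span {x (s n) - p}" for n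
      by (simp add: u_def span_scale span_base)
  qed
  ultimately have "a \<in> \<tau>" by blast
  have "a \<bullet> a = 0"
  proof (rule grassmannian_lim_orthogonal[OF \<tau>' a' _ \<open>a \<in> \<tau>\<close>])
    show "v \<bullet> u (s n) = 0" if "v \<in> tangent_space X (x (s n))" for n v
      using orth[OF that] by (simp add: u_def)
  qed
  moreover have "norm a = 1"
    using tendsto_norm[OF a'] by (simp add: norm_u LIMSEQ_const_iff)
  ultimately show False by simp
qed

text \<open>The stratum through the origin is handled by its own smoothness, every other stratum by Whitney's
  condition (b) along the stratum through the origin. Local finiteness makes one radius work for
  all strata at once.\<close>

lemma small_spheres_transverse_to_strata:
  fixes \<S> :: "'a::euclidean_space set set"
  assumes S: "whitney_stratification \<S>"
  obtains \<rho> where "\<rho> > 0"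
    "\<And>M w. M \<in> \<S> \<Longrightarrow> w \<in> M \<Longrightarrow> w \<noteq> 0 \<Longrightarrow> norm w < \<rho> \<Longrightarrow> \<exists>v\<in>tangent_space M w. v \<bullet> w \<noteq> 0"
proof -
  have part: "partition_on UNIV \<S>" and manifold: "\<And>M. M \<in> \<S> \<Longrightarrow> \<exists>d. smooth_submanifold d M"
    and locfin: "\<And>x. \<exists>U. open U \<and> x \<in> U \<and> finite {M \<in> \<S>. M \<inter> U \<noteq> {}}"
    and b: "\<And>X Y. X \<in> \<S> \<Longrightarrow> Y \<in> \<S> \<Longrightarrow> X \<noteq> Y \<Longrightarrow> whitney_b X Y"
    using S unfolding whitney_stratification_def by auto
  obtain Y where Y: "Y \<in> \<S>" "0 \<in> Y"
    using part unfolding partition_on_def by (metis UNIV_I UnionE)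
  have "\<exists>\<rho>>0. \<forall>w\<in>M. w \<noteq> 0 \<longrightarrow> norm w < \<rho> \<longrightarrow> (\<exists>v\<in>tangent_space M w. v \<bullet> w \<noteq> 0)"
    if M: "M \<in> \<S>" for M
  proof -
    obtain d where d: "smooth_submanifold d M" using manifold M by blast
    have "\<exists>\<rho>>0. \<forall>w\<in>M. w \<noteq> 0 \<longrightarrow> dist w 0 < \<rho> \<longrightarrow> (\<exists>v\<in>tangent_space M w. v \<bullet> (w - 0) \<noteq> 0)"
    proof (cases "M = Y")
      case True
      then have "0 \<in> M" using Y by simp
      then show ?thesis by (rule submanifold_radial_tangent_vector[OF d]) blast
    next
      case False
      show ?thesis
        by (rule whitney_b_radial_tangent_vector[OF d b[OF M Y(1) False] Y(2)]) blast
    qed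
    then show ?thesis by simp
  qed
  then obtain \<rho> where \<rho>: "\<And>M. M \<in> \<S> \<Longrightarrow> \<rho> M > 0"
    "\<And>M w. M \<in> \<S> \<Longrightarrow> w \<in> M \<Longrightarrow> w \<noteq> 0 \<Longrightarrow> norm w < \<rho> M \<Longrightarrow> \<exists>v\<in>tangent_space M w. v \<bullet> w \<noteq> 0"
    by metis
  obtain U where U: "open U" "0 \<in> U" and fin: "finite {M \<in> \<S>. M \<inter> U \<noteq> {}}"
    using locfin[of 0] by blast
  obtain e where e: "e > 0" "ball 0 e \<subseteq> U" using U open_contains_ball by blast
  let ?R = "Min (insert e (\<rho> ` {M \<in> \<S>. M \<inter> U \<noteq> {}}))"
  show ?thesis
  proof (rule that)
    show "?R > 0" using fin e \<rho>(1) by auto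
    fix M w assume w: "M \<in> \<S>" "w \<in> M" "w \<noteq> 0" "norm w < ?R"
    then have "norm w < e" using fin by simp
    then have "w \<in> U" using e(2) by auto
    then have "norm w < \<rho> M" using w fin by auto
    then show "\<exists>v\<in>tangent_space M w. v \<bullet> w \<noteq> 0" using \<rho>(2) w by blast
  qed
qed

theorem proposition11:
  fixes f :: "complex ^ 'n \<Rightarrow> complex" and \<S> :: "(complex ^ 'n) set set"
  assumes "mixed_polynomial f"
    and "whitney_stratification \<S>"
    and "\<exists>\<T>\<subseteq>\<S>. f -` {0} = \<Union>\<T>"
    and "thom_af f \<S>"
    and "nearby_fibers_smooth f"
  shows "\<exists>r0>0. \<forall>r1. 0 < r1 \<and> r1 \<le> r0 \<longrightarrow>
           (\<exists>\<delta>>0. \<forall>\<eta>. 0 < norm \<eta> \<and> norm \<eta> \<le> \<delta> \<longrightarrow>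
              (\<forall>r. r1 \<le> r \<and> r \<le> r0 \<longrightarrow> fiber_transverse_sphere f \<eta> r))"
proof -
  have C1: "C1_on UNIV f" by (rule mixed_polynomial_C1[OF assms(1)])
  obtain \<rho> where \<rho>: "\<rho> > 0" and radial: "\<And>M w. M \<in> \<S> \<Longrightarrow> w \<in> M \<Longrightarrow> w \<noteq> 0 \<Longrightarrow> norm w < \<rho> \<Longrightarrow>
      \<exists>v\<in>tangent_space M w. v \<bullet> w \<noteq> 0"
    using small_spheres_transverse_to_strata[OF assms(2)] by blast
  obtain R d where R: "R > 0" and d: "d > 0" and smooth: "fibers_smooth_in f R d"
    and thom_all: "\<forall>z w M \<tau>. (\<forall>i. z i \<in> cball 0 R \<and> f (z i) \<noteq> 0) \<and> z \<longlonglongrightarrow> w \<and> w \<noteq> 0 \<and>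
      M \<in> \<S> \<and> M \<subseteq> f -` {0} \<and> w \<in> M \<and>
      grassmannian_lim (2 * CARD('n) - 2) (\<lambda>i. tangent_space (f -` {f (z i)}) (z i)) \<tau>
      \<longrightarrow> tangent_space M w \<subseteq> \<tau>"
    using assms(4) unfolding thom_af_def by (elim exE conjE)
  have thom: "tangent_space M w \<subseteq> \<tau>"
    if "\<And>i. z i \<in> cball 0 R" "\<And>i. f (z i) \<noteq> 0" "z \<longlonglongrightarrow> w" "w \<noteq> 0" "M \<in> \<S>" "M \<subseteq> f -` {0}" "w \<in> M"
      "grassmannian_lim (2 * CARD('n) - 2) (\<lambda>i. tangent_space (f -` {f (z i)}) (z i)) \<tau>"
    for z w M \<tau>
    by (rule thom_all[rule_format, of z w M \<tau>]) (intro conjI allI that)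
  \<comment> \<open>Halving makes \<open>r0 < \<rho>\<close> strict: \<open>radial\<close> is known only on the open ball of radius \<open>\<rho>\<close>.\<close>
  define r0 where "r0 = min R (\<rho> / 2)"
  have r0: "r0 > 0" "r0 \<le> R" "r0 < \<rho>" using R \<rho> by (auto simp: r0_def)
  have not_crit: "\<not> critical_point f z" if "0 < norm (f z)" "norm (f z) \<le> d" "norm z \<le> r0" for z
    using smooth that r0(2) unfolding fibers_smooth_in_def by auto
  have fiber_tangent: "tangent_space (f -` {f z}) z \<in> grassmannian (2 * CARD('n) - 2)"
    if "\<not> critical_point f z" for z
    using tangent_space_level_set_in_grassmannian[OF C1 not_critical_point_surj[OF C1 that]]
    by (simp add: mult.commute)
  have transverse_vector: "\<exists>\<delta>>0. \<forall>z. r1 \<le> norm z \<and> norm z \<le> r0 \<and> 0 < norm (f z) \<and> norm (f z) \<le> \<delta> \<longrightarrow>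
      (\<exists>v\<in>tangent_space (f -` {f z}) z. v \<bullet> z \<noteq> 0)" if r1: "0 < r1" for r1
  proof (rule ccontr)
    assume contra: "\<not> ?thesis"
    \<comment> \<open>Staying below \<open>d\<close> keeps all points of the sequence noncritical, so their fibers have tangent planes of the expected dimension.\<close>
    define \<delta> where "\<delta> n = min d (inverse (real (Suc n)))" for n
    have "\<delta> n > 0" for n using d by (simp add: \<delta>_def)
    then have "\<exists>z. r1 \<le> norm z \<and> norm z \<le> r0 \<and> 0 < norm (f z) \<and> norm (f z) \<le> \<delta> n \<and>
      (\<forall>v\<in>tangent_space (f -` {f z}) z. v \<bullet> z = 0)" for n
      using contra by blast
    then obtain z where z: "\<And>n. r1 \<le> norm (z n)" "\<And>n. norm (z n) \<le> r0" "\<And>n. 0 < norm (f (z n))"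
      "\<And>n. norm (f (z n)) \<le> \<delta> n"
      and orth: "\<And>n v. v \<in> tangent_space (f -` {f (z n)}) (z n) \<Longrightarrow> v \<bullet> z n = 0"
      by metis
    have fz: "norm (f (z n)) \<le> d" "norm (f (z n)) \<le> inverse (real (Suc n))" for n
      using z(4)[of n] by (auto simp: \<delta>_def)
    have fz_lim: "(\<lambda>n. f (z n)) \<longlonglongrightarrow> 0"
    proof (rule metric_tendsto_imp_tendsto[OF LIMSEQ_inverse_real_of_nat], intro always_eventually allI)
      show "dist (f (z n)) 0 \<le> dist (inverse (real (Suc n))) 0" for n
        using fz(2)[of n] by simp
    qed
    define W where "W n = tangent_space (f -` {f (z n)}) (z n)" for n
    have W: "W n \<in> grassmannian (2 * CARD('n) - 2)" for n
      unfolding W_def by (intro fiber_tangent not_crit z fz)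
    obtain s1 \<tau> where s1: "strict_mono s1" and \<tau>: "grassmannian_lim (2 * CARD('n) - 2) (W \<circ> s1) \<tau>"
      using grassmannian_compact[OF W] .
    have "bounded (range (z \<circ> s1))"
      using z(2) by (auto simp: bounded_iff)
    then obtain s2 w where s2: "strict_mono (s2 :: nat \<Rightarrow> nat)" and w: "(z \<circ> s1 \<circ> s2) \<longlonglongrightarrow> w"
      using bounded_imp_convergent_subsequence by blast
    define s where "s = s1 \<circ> s2"
    have s: "strict_mono s" unfolding s_def by (intro strict_mono_o s1 s2)
    have w_lim: "(\<lambda>n. z (s n)) \<longlonglongrightarrow> w" using w by (simp add: s_def o_def)
    have \<tau>_lim: "grassmannian_lim (2 * CARD('n) - 2) (\<lambda>n. W (s n)) \<tau>"
      using grassmannian_lim_subseq[OF \<tau> s2] by (simp add: s_def o_def)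
    have w_norm: "r1 \<le> norm w" "norm w \<le> r0"
      using LIMSEQ_le_const[OF tendsto_norm[OF w_lim]] LIMSEQ_le_const2[OF tendsto_norm[OF w_lim]] z(1,2)
      by blast+
    then have "w \<noteq> 0" "norm w < \<rho>" using r1 r0 by auto
    have "isCont f w"
      using C1_on_imp_continuous_on[OF C1] by (simp add: continuous_on_eq_continuous_at)
    then have "(\<lambda>n. f (z (s n))) \<longlonglongrightarrow> f w"
      using w_lim by (rule isCont_tendsto_compose)
    moreover have "(\<lambda>n. f (z (s n))) \<longlonglongrightarrow> 0"
      using LIMSEQ_subseq_LIMSEQ[OF fz_lim s] by (simp add: o_def)
    ultimately have "f w = 0" by (rule LIMSEQ_unique)
    then obtain M where M: "M \<in> \<S>" "M \<subseteq> f -` {0}" "w \<in> M"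
      using assms(3) by blast
    have "tangent_space M w \<subseteq> \<tau>"
    proof (rule thom[OF _ _ w_lim \<open>w \<noteq> 0\<close> M])
      show "z (s i) \<in> cball 0 R" for i using z(2)[of "s i"] r0(2) by simp
      show "f (z (s i)) \<noteq> 0" for i using z(3)[of "s i"] by simp
      show "grassmannian_lim (2 * CARD('n) - 2) (\<lambda>i. tangent_space (f -` {f (z (s i))}) (z (s i))) \<tau>"
        using \<tau>_lim by (simp add: W_def)
    qed
    moreover have "v \<bullet> w = 0" if "v \<in> \<tau>" for v
      by (rule grassmannian_lim_orthogonal[OF \<tau>_lim w_lim _ that]) (simp add: W_def orth)
    ultimately show False
      using radial[OF M(1,3) \<open>w \<noteq> 0\<close> \<open>norm w < \<rho>\<close>] by blast
  qed
  show ?thesis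
  proof (rule exI[of _ r0], intro conjI r0(1) allI impI)
    fix r1 assume r1: "0 < r1 \<and> r1 \<le> r0"
    obtain \<delta> where \<delta>: "\<delta> > 0" and vec: "\<And>z. r1 \<le> norm z \<Longrightarrow> norm z \<le> r0 \<Longrightarrow> 0 < norm (f z) \<Longrightarrow>
        norm (f z) \<le> \<delta> \<Longrightarrow> \<exists>v\<in>tangent_space (f -` {f z}) z. v \<bullet> z \<noteq> 0"
      using transverse_vector[of r1] r1 by blast
    show "\<exists>\<delta>>0. \<forall>\<eta>. 0 < norm \<eta> \<and> norm \<eta> \<le> \<delta> \<longrightarrow>
        (\<forall>r. r1 \<le> r \<and> r \<le> r0 \<longrightarrow> fiber_transverse_sphere f \<eta> r)"
    proof (rule exI[of _ "min d \<delta>"], intro conjI allI impI)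
      show "min d \<delta> > 0" using d \<delta> by simp
      fix \<eta> :: complex and r :: real assume \<eta>: "0 < norm \<eta> \<and> norm \<eta> \<le> min d \<delta>" and r: "r1 \<le> r \<and> r \<le> r0"
      show "fiber_transverse_sphere f \<eta> r"
        unfolding fiber_transverse_sphere_def
      proof (intro ballI)
        fix z assume "z \<in> f -` {\<eta>} \<inter> sphere 0 r"
        then have z: "f z = \<eta>" "norm z = r" by auto
        have nc: "\<not> critical_point f z" using not_crit z \<eta> r by auto
        then have "subspace (tangent_space (f -` {f z}) z)"
          using fiber_tangent by (simp add: grassmannian_def)
        moreover obtain v where "v \<in> tangent_space (f -` {f z}) z" "v \<bullet> z \<noteq> 0"
          using vec[of z] z \<eta> r by auto
        ultimately have "transverse_at (f -` {f z}) (sphere 0 (norm z)) z"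
          by (rule transverse_at_sphereI)
        with nc show "\<not> critical_point f z \<and> transverse_at (f -` {\<eta>}) (sphere 0 r) z"
          unfolding z by blast
      qed
    qed
  qed
qed

end
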